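(* For all positive integers $k,n$, every integer $r\geq 1$ and every $z\in\mathbb{C}$, $$\sum_{m\geq 1}p_{r\text{-}\mathrm{mex}}(m,n)\,m^k z^m=\sum_{m\geq 0}\Big[(m+1)^k z^{m+1}-m^k z^m\Big]\,p\big(n-t_r(m)\big).$$
   Context: For an integer $n\ge 0$, $p(n)$ denotes the number of partitions of $n$, with $p(0)=1$ and $p(n)=0$ for $n<0$. For an integer $r\geq 1$ and a partition $\pi$, $r\text{-}\mathrm{mex}(\pi)$ (the least $r$-gap) is the least positive integer that does not occur at least $r$ times as a part of $\pi$. $p_{r\text{-}\mathrm{mex}}(m,n)$ is the number of partitions $\pi$ of $n$ with $r\text{-}\mathrm{mex}(\pi)=m$. For $m\geq 0$, $t_r(m):=r\cdot\frac{m(m+1)}{2}$. All sums are finite (only finitely many nonzero terms). *)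

theory Defs
  imports "HOL-Analysis.Analysis" "HOL-Library.Multiset"
begin

definition partitions :: "nat \<Rightarrow> nat multiset set" where
  "partitions n = {\<pi>. 0 \<notin># \<pi> \<and> sum_mset \<pi> = n}"

definition p :: "int \<Rightarrow> nat" where
  "p n = (if n < 0 then 0 else card (partitions (nat n)))"

definition r_mex :: "nat \<Rightarrow> nat multiset \<Rightarrow> nat" where
  "r_mex r \<pi> = (LEAST m. 0 < m \<and> \<not> r \<le> count \<pi> m)"

definition p_r_mex :: "nat \<Rightarrow> nat \<Rightarrow> nat \<Rightarrow> nat" where
  "p_r_mex r m n = card {\<pi> \<in> partitions n. r_mex r \<pi> = m}"

definition t :: "nat \<Rightarrow> nat \<Rightarrow> nat" where
  "t r m = r * (m * (m + 1) div 2)"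

text \<open>The cardinalities above are of finite sets, the minimum defining \<open>r_mex\<close> exists for
  \<open>r \<ge> 1\<close>, and the sums over \<open>m\<close> of terms with a factor \<open>p_r_mex r m n\<close> or \<open>p (n - t r m)\<close> have
  finite support, so that \<open>infsum\<close> is the ordinary finite sum for them.\<close>

lemma partition_part_le:
  assumes "\<pi> \<in> partitions n" "x \<in># \<pi>"
  shows "x \<le> n"
  using assms by (auto simp: partitions_def dest: multi_member_split)

lemma finite_partitions: "finite (partitions n)"
proof -
  have "size \<pi> \<le> n" if "\<pi> \<in> partitions n" for \<pi>
  proof -
    have "size \<pi> \<le> sum_mset \<pi>" if "0 \<notin># \<pi>" for \<pi> :: "nat multiset"
      using that by (induction \<pi>) auto
    with that show ?thesis by (auto simp: partitions_def)
  qed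
  hence "partitions n \<subseteq> (\<Union>s\<le>n. {\<pi>. set_mset \<pi> \<subseteq> {..n} \<and> size \<pi> = s})"
    using partition_part_le by fastforce
  moreover have "finite {\<pi>. set_mset \<pi> \<subseteq> {..n} \<and> size \<pi> = s}" for s
  proof -
    have "{\<pi>. set_mset \<pi> \<subseteq> {..n} \<and> size \<pi> = s}
        \<subseteq> mset ` {xs. set xs \<subseteq> {..n} \<and> length xs = s}"
    proof safe
      fix \<pi> :: "nat multiset"
      assume a: "set_mset \<pi> \<subseteq> {..n}"
      obtain xs where "mset xs = \<pi>" using ex_mset by blast
      thus "\<pi> \<in> mset ` {xs. set xs \<subseteq> {..n} \<and> length xs = size \<pi>}" using a by auto
    qed
    thus ?thesis by (rule finite_subset) (simp add: finite_lists_length_eq)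
  qed
  ultimately show ?thesis by (auto intro: finite_subset)
qed

lemma p_0: "p 0 = 1"
proof -
  have "partitions 0 = {{#}}"
    by (auto simp: partitions_def sum_mset_0_iff) (metis multiset_nonemptyE)
  thus ?thesis by (simp add: p_def)
qed

lemma r_mex_props:
  assumes "r \<ge> 1" "\<pi> \<in> partitions n"
  shows "0 < r_mex r \<pi>" "\<not> r \<le> count \<pi> (r_mex r \<pi>)"
    and "\<And>j. 0 < j \<Longrightarrow> j < r_mex r \<pi> \<Longrightarrow> r \<le> count \<pi> j"
    and "r_mex r \<pi> \<le> n + 1"
proof -
  have "Suc n \<notin># \<pi>" using partition_part_le[OF assms(2), of "Suc n"] by auto
  hence *: "0 < Suc n \<and> \<not> r \<le> count \<pi> (Suc n)"
    using assms(1) by (auto simp: not_in_iff)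
  show "0 < r_mex r \<pi>" "\<not> r \<le> count \<pi> (r_mex r \<pi>)"
    unfolding r_mex_def using LeastI[where P = "\<lambda>m. 0 < m \<and> \<not> r \<le> count \<pi> m", OF *] by auto
  show "r_mex r \<pi> \<le> n + 1"
    unfolding r_mex_def using Least_le[where P = "\<lambda>m. 0 < m \<and> \<not> r \<le> count \<pi> m", OF *] by simp
  show "r \<le> count \<pi> j" if "0 < j" "j < r_mex r \<pi>" for j
    using not_less_Least[of j "\<lambda>m. 0 < m \<and> \<not> r \<le> count \<pi> m"] that by (auto simp: r_mex_def)
qed

lemma finite_support_p_r_mex:
  assumes "r \<ge> 1"
  shows "finite {m. p_r_mex r m n \<noteq> 0}"
proof (rule finite_subset)
  show "{m. p_r_mex r m n \<noteq> 0} \<subseteq> r_mex r ` partitions n"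
    by (auto simp: p_r_mex_def card_eq_0_iff)
qed (simp add: finite_partitions)

lemma finite_support_p:
  assumes "r \<ge> 1"
  shows "finite {m. p (int n - int (t r m)) \<noteq> 0}"
proof (rule finite_subset)
  show "{m. p (int n - int (t r m)) \<noteq> 0} \<subseteq> {..n}"
  proof
    fix m assume "m \<in> {m. p (int n - int (t r m)) \<noteq> 0}"
    hence a: "p (int n - int (t r m)) \<noteq> 0" by simp
    have "m * 2 \<le> m * (m + 1)" by (cases m) auto
    hence "m \<le> m * (m + 1) div 2" by linarith
    also have "\<dots> \<le> t r m" using assms by (cases r) (auto simp: t_def)
    also have "t r m \<le> n" using a by (auto simp: p_def split: if_splits)
    finally show "m \<in> {..n}" by simp
  qed
qed simp

end

theory Submission
  imports Defs
begin

text \<open>A partition has \<open>r\<close>-mex greater than \<open>m\<close> iff it contains \<open>r\<close> copies of each of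
  \<open>1, \<dots>, m\<close>; removing these copies, which sum to \<open>t r m\<close>, leaves an arbitrary partition of
  \<open>n - t r m\<close>. Hence \<open>p (n - t r m)\<close> counts the partitions of \<open>n\<close> with \<open>r\<close>-mex greater than \<open>m\<close>,
  and with \<open>f m = m ^ k * z ^ m\<close> the right-hand side telescopes, partition by partition, to the sum
  of \<open>f (r_mex r \<pi>) - f 0\<close>, where \<open>f 0 = 0\<close> because \<open>k \<ge> 1\<close>.\<close>

definition staircase :: "nat \<Rightarrow> nat \<Rightarrow> nat multiset" where
  "staircase r m = repeat_mset r (mset_set {1..m})"

lemma count_staircase: "count (staircase r m) j = (if j \<in> {1..m} then r else 0)"
  by (simp add: staircase_def count_mset_set')

lemma sum_mset_staircase: "sum_mset (staircase r m) = t r m"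
proof -
  have "sum_mset (repeat_mset r M) = r * sum_mset M" for M :: "nat multiset"
    by (induction r) auto
  moreover have "sum_mset (mset_set {1..m}) = m * (m + 1) div 2"
    using sum_unfold_sum_mset[of "\<lambda>i. i" "{1..m}"] gauss_sum_from_Suc_0[where 'a = nat, of m]
    by simp
  ultimately show ?thesis by (simp add: staircase_def t_def)
qed

lemma less_r_mex_iff_staircase_subset:
  assumes "r \<ge> 1" "\<pi> \<in> partitions n"
  shows "m < r_mex r \<pi> \<longleftrightarrow> staircase r m \<subseteq># \<pi>"
proof
  assume "m < r_mex r \<pi>"
  then show "staircase r m \<subseteq># \<pi>"
    using r_mex_props(3)[OF assms] by (auto simp: subseteq_mset_def count_staircase)
next
  assume sub: "staircase r m \<subseteq># \<pi>"
  have "r \<le> count \<pi> j" if "j \<in> {1..m}" for j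
    using mset_subset_eq_count[OF sub, of j] that by (simp add: count_staircase)
  \<comment> \<open>The \<open>r\<close>-mex occurs fewer than \<open>r\<close> times, so it is none
    of 1, ..., \<open>m\<close>; being positive, it exceeds \<open>m\<close>.\<close>
  then have "r_mex r \<pi> \<notin> {1..m}"
    using r_mex_props(2)[OF assms] by blast
  then show "m < r_mex r \<pi>"
    using r_mex_props(1)[OF assms] by simp
qed

lemma card_partitions_r_mex_gt:
  assumes "r \<ge> 1"
  shows "card {\<pi> \<in> partitions n. m < r_mex r \<pi>} = p (int n - int (t r m))"
proof -
  have eq: "{\<pi> \<in> partitions n. m < r_mex r \<pi>} = {\<pi> \<in> partitions n. staircase r m \<subseteq># \<pi>}"
    using less_r_mex_iff_staircase_subset[OF assms] by blast
  have zero: "0 \<notin># staircase r m"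
    by (simp add: not_in_iff count_staircase)
  have le: "t r m \<le> n" if "\<pi> \<in> partitions n" "staircase r m \<subseteq># \<pi>" for \<pi>
    using that by (auto simp: partitions_def sum_mset_staircase subset_mset.le_iff_add)
  show ?thesis
  proof (cases "t r m \<le> n")
    case True
    \<comment> \<open>Adding the staircase undoes its removal, and neither operation introduces a
      part 0 because \<open>zero\<close> holds. Cancellation makes the map injective, so
      cardinalities agree.\<close>
    have "{\<pi> \<in> partitions n. staircase r m \<subseteq># \<pi>}
        = (\<lambda>\<mu>. staircase r m + \<mu>) ` partitions (n - t r m)"
      using True zero
      by (auto simp: partitions_def sum_mset_staircase subset_mset.le_iff_add)
    then have "card {\<pi> \<in> partitions n. staircase r m \<subseteq># \<pi>} = card (partitions (n - t r m))"
      by (simp add: card_image)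
    then show ?thesis
      using True by (simp add: eq p_def nat_diff_distrib)
  next
    \<comment> \<open>The staircase is too large to fit, which matches the value 0 of
      \<open>p\<close> at negative arguments.\<close>
    case False
    then have "{\<pi> \<in> partitions n. staircase r m \<subseteq># \<pi>} = {}"
      using le by blast
    then show ?thesis
      using False unfolding eq by (simp only: card.empty) (simp add: p_def)
  qed
qed

text \<open>Terms that vanish outside a finite set reduce both sides of the theorem to finite sums,
  with no summability argument.\<close>

lemma infsum_eq_sum:
  assumes "finite B" "B \<subseteq> A" "\<And>x. x \<in> A - B \<Longrightarrow> f x = 0"
  shows "infsum f A = sum f B"
proof -
  have "infsum f A = infsum f B"
    by (rule infsum_cong_neutral) (use assms in auto)
  with assms(1) show ?thesis
    by simp
qed

text \<open>Group the partitions of \<open>n\<close> by their \<open>r\<close>-mex, which lies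
  between 1 and \<open>n + 1\<close>; \<open>f\<close> is constant on each group.\<close>

lemma sum_p_r_mex:
  fixes f :: "nat \<Rightarrow> 'a::comm_semiring_1"
  assumes "r \<ge> 1"
  shows "(\<Sum>m=1..n+1. of_nat (p_r_mex r m n) * f m) = (\<Sum>\<pi>\<in>partitions n. f (r_mex r \<pi>))"
proof -
  have "(\<Sum>\<pi>\<in>partitions n. f (r_mex r \<pi>))
      = (\<Sum>m=1..n+1. \<Sum>\<pi> | \<pi> \<in> partitions n \<and> r_mex r \<pi> = m. f (r_mex r \<pi>))"
    using r_mex_props(1,4)[OF assms]
    by (intro sum.group[symmetric]) (auto simp: finite_partitions Suc_le_eq)
  then show ?thesis
    by (simp add: p_r_mex_def)
qed

text \<open>Read \<open>p\<close> as a count of partitions, exchange the two summations, and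
  telescope the inner sum for each partition.\<close>

lemma sum_diff_mult_p:
  fixes f :: "nat \<Rightarrow> 'a::comm_ring_1"
  assumes "r \<ge> 1"
  shows "(\<Sum>m\<le>n. (f (m + 1) - f m) * of_nat (p (int n - int (t r m))))
      = (\<Sum>\<pi>\<in>partitions n. f (r_mex r \<pi>) - f 0)"
proof -
  have "(\<Sum>m\<le>n. (f (m + 1) - f m) * of_nat (p (int n - int (t r m))))
      = (\<Sum>m\<le>n. \<Sum>\<pi> | \<pi> \<in> partitions n \<and> m < r_mex r \<pi>. f (m + 1) - f m)"
    by (simp add: card_partitions_r_mex_gt[OF assms, symmetric] mult.commute)
  also have "\<dots> = (\<Sum>\<pi>\<in>partitions n. \<Sum>m | m \<in> {..n} \<and> m < r_mex r \<pi>. f (m + 1) - f m)"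
    by (rule sum.swap_restrict) (auto simp: finite_partitions)
  \<comment> \<open>The cutoff at \<open>n\<close> loses nothing: the \<open>r\<close>-mex is at
    most \<open>n + 1\<close>, so every \<open>m\<close> below it is at most
    \<open>n\<close>.\<close>
  also have "\<dots> = (\<Sum>\<pi>\<in>partitions n. \<Sum>m<r_mex r \<pi>. f (m + 1) - f m)"
    using r_mex_props(4)[OF assms] by (intro sum.cong) fastforce+
  finally show ?thesis
    by (simp add: sum_lessThan_telescope)
qed

theorem theorem1p2:
  fixes k n r :: nat and z :: complex
  assumes "k \<ge> 1" and "n \<ge> 1" and "r \<ge> 1"
  shows "(\<Sum>\<^sub>\<infinity>m\<in>{1..}. of_nat (p_r_mex r m n) * of_nat m ^ k * z ^ m) =
    (\<Sum>\<^sub>\<infinity>m. (of_nat (m + 1) ^ k * z ^ (m + 1) - of_nat m ^ k * z ^ m) *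
       of_nat (p (int n - int (t r m))))"
proof -
  define f where "f m = of_nat m ^ k * z ^ m" for m
  have f0: "f 0 = 0"
    using assms(1) by (simp add: f_def)
  have "p_r_mex r m n = 0" if "m > n + 1" for m
  proof -
    have "{\<pi> \<in> partitions n. r_mex r \<pi> = m} = {}"
      using r_mex_props(4)[OF assms(3)] that by fastforce
    then show ?thesis
      unfolding p_r_mex_def by (simp only: card.empty)
  qed
  then have "(\<Sum>\<^sub>\<infinity>m\<in>{1..}. of_nat (p_r_mex r m n) * f m)
      = (\<Sum>m=1..n+1. of_nat (p_r_mex r m n) * f m)"
    by (intro infsum_eq_sum) auto
  also have "\<dots> = (\<Sum>\<pi>\<in>partitions n. f (r_mex r \<pi>) - f 0)"
    by (subst sum_p_r_mex[OF assms(3)]) (simp add: f0)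
  also have "\<dots> = (\<Sum>m\<le>n. (f (m + 1) - f m) * of_nat (p (int n - int (t r m))))"
    by (rule sum_diff_mult_p[OF assms(3), symmetric])
  also have "\<dots> = (\<Sum>\<^sub>\<infinity>m. (f (m + 1) - f m) * of_nat (p (int n - int (t r m))))"
  proof (rule infsum_eq_sum[symmetric])
    \<comment> \<open>For \<open>m > n\<close> no partition of \<open>n\<close> has
      \<open>r\<close>-mex above \<open>m\<close>, so the counting lemma makes the \<open>p\<close>
      factor 0 without any estimate of \<open>t r m\<close>.\<close>
    fix m assume "m \<in> UNIV - {..n}"
    then have "{\<pi> \<in> partitions n. m < r_mex r \<pi>} = {}"
      using r_mex_props(4)[OF assms(3)] by fastforce
    then show "(f (m + 1) - f m) * of_nat (p (int n - int (t r m))) = 0"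
      by (simp only: card_partitions_r_mex_gt[OF assms(3), symmetric] card.empty of_nat_0 mult_zero_right)
  qed auto
  finally show ?thesis
    by (simp add: f_def mult.assoc)
qed

end
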